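(* In the parametric multi-agent persistent monitoring system with $N$ agents and $M$ targets described in the context, let $j\in\{1,\ldots,N\}$. Then $I_j(t)\cup\{\rho_i^0 : i\notin\mathcal{T}_j(t)\}$, $t\in[0,T]$, is a sufficient event set to evaluate the IPA gradient $\nabla_jJ(\bm{\theta},\mathbf{w})$. That is, $\nabla_jJ(\bm{\theta},\mathbf{w})$ is uniquely determined by what agent $j$ knows under the limited information model from (i) its local information set $I_j(t)$, $t\in[0,T]$, and (ii) the occurrence times of the events $\rho_i^0$ ("$R_i$ hits $0$") for targets $i$ that are not in $\mathcal{T}_j(t)$ at the time $t$ of occurrence.
   Context: **Agents and targets.** $N$ agents have positions $s_j(t)\in[0,L]$ with $\dot s_j(t)=u_j(t)$, $|u_j(t)|\le 1$; initial positions are given. There are $M$ targets at known fixed positions $x_i\in[0,L]$. Agent $j$ has sensing range $r_j>0$ and detects target $i$ with probability $p_{ij}(s_j)=\max\{0,1-|x_i-s_j|/r_j\}$. The derivative $\partial p_{ij}/\partial s_j$ takes values in $\{0,\pm 1/r_j\}$, is $0$ whenever $p_{ij}=0$, and has some fixed value of this set at the kink $s_j=x_i$. The joint detection probability of target $i$ is $P_i(\mathbf{s}(t))=1-\prod_{j=1}^N(1-p_{ij}(s_j(t)))$, $\mathbf{s}=[s_1,\ldots,s_N]^{\mathrm T}$. Target uncertainty $R_i(t)\ge 0$, with given $R_i(0)$, satisfies $\dot R_i(t)=0$ if $R_i(t)=0$ and $A_i\le B_iP_i(\mathbf{s}(t))$, and $\dot R_i(t)=A_i-B_iP_i(\mathbf{s}(t))$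 otherwise, with constants $B_i>A_i>0$. **Parametric trajectories and cost.** Controls take values in $\{-1,0,1\}$. The trajectory of agent $j$ on $[0,T]$ is determined by a finite vector of switching points $\bm{\theta}_j=[\theta_{j1},\ldots,\theta_{j\Gamma}]$, $\theta_{jl}\in[0,L]$, and a finite vector of dwell times $\mathbf{w}_j\ge0$: the agent moves at unit speed from $s_j(0)$ to $\theta_{j1}$, then to $\theta_{j2}$, etc.; at a switching point it either reverses direction immediately or stops ($u_j=0$) for the associated dwell time before moving on. $\bm{\theta}$ and $\mathbf{w}$ collect all $\bm{\theta}_j$, $\mathbf{w}_j$. The cost is $J(\bm{\theta},\mathbf{w})=\frac1T\int_0^T\sum_{i=1}^M R_i(t)\,dt$. **Neighborhoods.** $\mathcal{A}_j(t)=\{k\ne j:|s_k(t)-s_j(t)|\le r_c\}$ with communication range $r_c$; $\mathcal{T}_j(t)=\{i:|x_i-s_j(t)|\le r_j\}$ (target neighborhood of agent $j$); $\mathcal{B}_i(t)=\{j:|s_j(t)-x_i|\le r_j\}$ (agent neighborhood of target $i$); $\mathcal{N}_{ij}(t)=\mathcal{B}_i(t)\setminus\{j\}$. Agents are homogeneous with common range $r_j=r$, and $r_c\ge 2r$. **Events.** For all $i,j$: type I: $\rho_i^0$ ($R_i$ hits $0$, i.e. the dynamics of $R_i$ switch from $A_i-B_iP_i$ to $0$) and $\rho_i^+$ ($R_i$ leaves $0$, the dynamics switch back). Type II: $\pi_{ij}^0$ and $\pi_{ij}^+$ ($p_{ij}(s_j(t))$ hits, respectively leaves, $0$). Type III: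 $\nu_j^{(a,b)}$ ($u_j$ switches from $a$ to $b$, $a\neq b$ in $\{-1,0,1\}$). Type IV: $\Delta_{ij}^+$ and $\Delta_{ij}^-$ (an agent is added to, respectively removed from, $\mathcal{N}_{ij}$). There are finitely many events on $[0,T]$. $\mathcal{E}_j^A$ is the set of type III events of agent $j$; $\mathcal{E}_i^T$ is the set of type I, II, IV events related to target $i$. The local event set of agent $j$ is $\mathcal{E}_j(t)=\mathcal{E}_j^A\cup\bigcup_{i\in\mathcal{T}_j(t)}\mathcal{E}_i^T$, and its local information set is $I_j(t)=\mathcal{E}_j(t)\cup\bigcup_{i\in\mathcal{T}_j(t),\,k\in\mathcal{N}_{ij}(t)}\mathcal{E}_k(t)$. Being given an event set means knowing which of these events occur and when. In the limited information model, agent $j$ knows the model constants and its own parameters and trajectory, observes the state $R_i(t)$ of every target with $p_{ij}(s_j(t))>0$, and obtains by communication from its neighbors (those in $\mathcal N_{ij}(t)$, $i\in\mathcal T_j(t)$) their current positions and speeds and their observations of targets in their sensing range. All communication is without delay. **IPA gradients.** $\nabla_j$ denotes the derivative with respect to $(\bm{\theta}_j,\mathbf{w}_j)$. $\nabla_js_j(t)$ is the derivative of $s_j(t)$ (constant between type III events of agent $j$, right-continuous), and $\nabla_k s_j=0$ for $k\ne j$. The IPA derivative $\nabla_jR_i(t)$ is the right-continuous function with $\nabla_jR_i(0)=0$ such that between consecutive events $\frac{d}{dt}\nabla_jR_i(t)=0$ when $R_i(t)=0$ and $A_i\le B_iP_i(\mathbf{s}(t))$, and $$\frac{d}{dt}\nabla_jR_i(t)=-B_i\frac{\partial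 p_{ij}(s_j(t))}{\partial s_j}\,\nabla_js_j(t)\prod_{g\in\mathcal{N}_{ij}(t)}\bigl(1-p_{ig}(s_g(t))\bigr)$$ otherwise; at an event $\rho_i^0$ it is reset to $0$; at all other events it is continuous. The IPA gradient is $\nabla_jJ(\bm{\theta},\mathbf{w})=\frac1T\sum_{i=1}^M\int_0^T\nabla_jR_i(t)\,dt$. *)

theory Defs
  imports "HOL-Analysis.Analysis"
begin

text \<open>Agents are numbered \<open>1..N\<close>, targets \<open>1..M\<close>. Agents are homogeneous, so the sensing range is a
  single number. The field \<open>kink i j\<close> is the fixed value given to the derivative of
  \<open>p\<^sub>i\<^sub>j\<close> at \<open>s\<^sub>j = x\<^sub>i\<close>.\<close>

record model =
  agents :: nat
  targets :: nat
  len :: real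
  horizon :: real
  loc :: "nat \<Rightarrow> real"
  growth :: "nat \<Rightarrow> real"
  decay :: "nat \<Rightarrow> real"
  sense :: real
  comm :: real
  kink :: "nat \<Rightarrow> nat \<Rightarrow> real"

definition valid_model :: "model \<Rightarrow> bool" where
  "valid_model m \<longleftrightarrow>
     0 < len m \<and> 0 < horizon m \<and> 0 < sense m \<and> 2 * sense m \<le> comm m \<and>
     (\<forall>i\<in>{1..targets m}. loc m i \<in> {0..len m} \<and> 0 < growth m i \<and> growth m i < decay m i \<and>
        (\<forall>j\<in>{1..agents m}. kink m i j \<in> {0, 1 / sense m, - (1 / sense m)}))"

text \<open>One execution of the system: initial positions and parameters of all agents, together with
  the target uncertainties \<open>R\<^sub>i(t)\<close> (which include the initial values \<open>R\<^sub>i(0)\<close>). The \<open>l\<close>-th dwell time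
  belongs to the \<open>l\<close>-th switching point; dwell time \<open>0\<close> stands for an immediate reversal.\<close>

record execution =
  init :: "nat \<Rightarrow> real"
  switches :: "nat \<Rightarrow> real list"
  dwells :: "nat \<Rightarrow> real list"
  unc :: "nat \<Rightarrow> real \<Rightarrow> real"


section \<open>Parametric trajectories\<close>

text \<open>Start at \<open>s\<close> and process pairs (switching point, dwell time); after the last pair the agent
  stays where it is.\<close>

fun traj :: "real \<Rightarrow> (real \<times> real) list \<Rightarrow> real \<Rightarrow> real" where
  "traj s [] t = s"
| "traj s ((\<theta>, w) # ps) t =
     (if t < \<bar>\<theta> - s\<bar> then s + sgn (\<theta> - s) * t
      else if t < \<bar>\<theta> - s\<bar> + w then \<theta>
      else traj \<theta> ps (t - (\<bar>\<theta> - s\<bar> + w)))"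

fun control :: "real \<Rightarrow> (real \<times> real) list \<Rightarrow> real \<Rightarrow> real" where
  "control s [] t = 0"
| "control s ((\<theta>, w) # ps) t =
     (if t < \<bar>\<theta> - s\<bar> then sgn (\<theta> - s)
      else if t < \<bar>\<theta> - s\<bar> + w then 0
      else control \<theta> ps (t - (\<bar>\<theta> - s\<bar> + w)))"

fun reverse_or_dwell :: "real \<Rightarrow> (real \<times> real) list \<Rightarrow> bool" where
  "reverse_or_dwell s ((\<theta>, w) # (\<theta>', w') # ps) \<longleftrightarrow>
     (0 < w \<or> (\<theta> - s) * (\<theta>' - \<theta>) < 0) \<and> reverse_or_dwell \<theta> ((\<theta>', w') # ps)"
| "reverse_or_dwell s _ \<longleftrightarrow> True"

definition pos :: "execution \<Rightarrow> nat \<Rightarrow> real \<Rightarrow> real" where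
  "pos e j = traj (init e j) (zip (switches e j) (dwells e j))"

definition speed :: "execution \<Rightarrow> nat \<Rightarrow> real \<Rightarrow> real" where
  "speed e j = control (init e j) (zip (switches e j) (dwells e j))"

definition valid_agent :: "model \<Rightarrow> execution \<Rightarrow> nat \<Rightarrow> bool" where
  "valid_agent m e j \<longleftrightarrow>
     init e j \<in> {0..len m} \<and> length (dwells e j) = length (switches e j) \<and>
     set (switches e j) \<subseteq> {0..len m} \<and> set (dwells e j) \<subseteq> {0..} \<and>
     reverse_or_dwell (init e j) (zip (switches e j) (dwells e j))"


section \<open>Detection and target uncertainty\<close>

definition detect :: "model \<Rightarrow> nat \<Rightarrow> real \<Rightarrow> real" where
  "detect m i s = max 0 (1 - \<bar>loc m i - s\<bar> / sense m)"

definition detect_deriv :: "model \<Rightarrow> nat \<Rightarrow> nat \<Rightarrow> real \<Rightarrow> real" where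
  "detect_deriv m i j s =
     (if detect m i s = 0 then 0
      else if s < loc m i then 1 / sense m
      else if loc m i < s then - (1 / sense m)
      else kink m i j)"

definition joint_detect :: "model \<Rightarrow> execution \<Rightarrow> nat \<Rightarrow> real \<Rightarrow> real" where
  "joint_detect m e i t = 1 - (\<Prod>j\<in>{1..agents m}. 1 - detect m i (pos e j t))"

definition at_rest :: "model \<Rightarrow> execution \<Rightarrow> nat \<Rightarrow> real \<Rightarrow> bool" where
  "at_rest m e i t \<longleftrightarrow> unc e i t = 0 \<and> growth m i \<le> decay m i * joint_detect m e i t"

text \<open>Since the right-hand side jumps when \<open>R\<^sub>i\<close> hits \<open>0\<close>, the differential equation is read with the
  right derivative.\<close>

definition valid_uncertainty :: "model \<Rightarrow> execution \<Rightarrow> nat \<Rightarrow> bool" where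
  "valid_uncertainty m e i \<longleftrightarrow>
     continuous_on {0..horizon m} (unc e i) \<and>
     (\<forall>t\<in>{0..horizon m}. 0 \<le> unc e i t) \<and>
     (\<forall>t\<in>{0..<horizon m}.
        (unc e i has_real_derivative
           (if at_rest m e i t then 0 else growth m i - decay m i * joint_detect m e i t))
          (at_right t))"


section \<open>Neighborhoods\<close>

definition agent_nbrs :: "model \<Rightarrow> execution \<Rightarrow> nat \<Rightarrow> real \<Rightarrow> nat set" where
  "agent_nbrs m e j t = {k\<in>{1..agents m}. k \<noteq> j \<and> \<bar>pos e k t - pos e j t\<bar> \<le> comm m}"

definition target_nbhd :: "model \<Rightarrow> execution \<Rightarrow> nat \<Rightarrow> real \<Rightarrow> nat set" where
  "target_nbhd m e j t = {i\<in>{1..targets m}. \<bar>loc m i - pos e j t\<bar> \<le> sense m}"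

definition agent_nbhd :: "model \<Rightarrow> execution \<Rightarrow> nat \<Rightarrow> real \<Rightarrow> nat set" where
  "agent_nbhd m e i t = {j\<in>{1..agents m}. \<bar>pos e j t - loc m i\<bar> \<le> sense m}"

definition collaborators :: "model \<Rightarrow> execution \<Rightarrow> nat \<Rightarrow> nat \<Rightarrow> real \<Rightarrow> nat set" where
  "collaborators m e i j t = agent_nbhd m e i t - {j}"


section \<open>Events\<close>

datatype event =
    Unc_Hits nat                   \<comment> \<open>\<open>\<rho>\<^sub>i\<^sup>0\<close>\<close>
  | Unc_Leaves nat                 \<comment> \<open>\<open>\<rho>\<^sub>i\<^sup>+\<close>\<close>
  | Detect_Hits nat nat            \<comment> \<open>\<open>\<pi>\<^sub>i\<^sub>j\<^sup>0\<close>\<close>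
  | Detect_Leaves nat nat          \<comment> \<open>\<open>\<pi>\<^sub>i\<^sub>j\<^sup>+\<close>\<close>
  | Control_Switch nat real real   \<comment> \<open>agent, old and new control\<close>
  | Nbr_Added nat nat              \<comment> \<open>\<open>\<Delta>\<^sub>i\<^sub>j\<^sup>+\<close>\<close>
  | Nbr_Removed nat nat            \<comment> \<open>\<open>\<Delta>\<^sub>i\<^sub>j\<^sup>-\<close>\<close>

text \<open>All conditions whose onset or end is an event hold on (relatively) closed sets of times, so that
  they hold at the event time itself. In particular membership in \<open>collaborators\<close> is such a condition.\<close>

definition begins :: "real \<Rightarrow> (real \<Rightarrow> bool) \<Rightarrow> real \<Rightarrow> bool" where
  "begins T P t \<longleftrightarrow> 0 < t \<and> t \<le> T \<and> P t \<and> (\<forall>\<^sub>F \<tau> in at_left t. \<not> P \<tau>)"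

definition ceases :: "real \<Rightarrow> (real \<Rightarrow> bool) \<Rightarrow> real \<Rightarrow> bool" where
  "ceases T P t \<longleftrightarrow> 0 \<le> t \<and> t < T \<and> P t \<and> (\<forall>\<^sub>F \<tau> in at_right t. \<not> P \<tau>)"

fun occurs :: "model \<Rightarrow> execution \<Rightarrow> event \<Rightarrow> real \<Rightarrow> bool" where
  "occurs m e (Unc_Hits i) t = begins (horizon m) (at_rest m e i) t"
| "occurs m e (Unc_Leaves i) t = ceases (horizon m) (at_rest m e i) t"
| "occurs m e (Detect_Hits i j) t = begins (horizon m) (\<lambda>\<tau>. detect m i (pos e j \<tau>) = 0) t"
| "occurs m e (Detect_Leaves i j) t = ceases (horizon m) (\<lambda>\<tau>. detect m i (pos e j \<tau>) = 0) t"
| "occurs m e (Control_Switch j a b) t \<longleftrightarrow>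
     0 < t \<and> t < horizon m \<and> a \<noteq> b \<and>
     (\<forall>\<^sub>F \<tau> in at_left t. speed e j \<tau> = a) \<and> (\<forall>\<^sub>F \<tau> in at_right t. speed e j \<tau> = b)"
| "occurs m e (Nbr_Added i j) t \<longleftrightarrow>
     (\<exists>k. begins (horizon m) (\<lambda>\<tau>. k \<in> collaborators m e i j \<tau>) t)"
| "occurs m e (Nbr_Removed i j) t \<longleftrightarrow>
     (\<exists>k. ceases (horizon m) (\<lambda>\<tau>. k \<in> collaborators m e i j \<tau>) t)"

definition agent_events :: "nat \<Rightarrow> event set" where
  "agent_events j = {Control_Switch j a b | a b. a \<in> {-1, 0, 1} \<and> b \<in> {-1, 0, 1} \<and> a \<noteq> b}"

definition target_events :: "model \<Rightarrow> nat \<Rightarrow> event set" where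
  "target_events m i =
     {Unc_Hits i, Unc_Leaves i} \<union>
     (\<Union>j\<in>{1..agents m}. {Detect_Hits i j, Detect_Leaves i j, Nbr_Added i j, Nbr_Removed i j})"

definition all_events :: "model \<Rightarrow> event set" where
  "all_events m =
     (\<Union>j\<in>{1..agents m}. agent_events j) \<union> (\<Union>i\<in>{1..targets m}. target_events m i)"

definition local_events :: "model \<Rightarrow> execution \<Rightarrow> nat \<Rightarrow> real \<Rightarrow> event set" where
  "local_events m e j t = agent_events j \<union> (\<Union>i\<in>target_nbhd m e j t. target_events m i)"

definition local_info :: "model \<Rightarrow> execution \<Rightarrow> nat \<Rightarrow> real \<Rightarrow> event set" where
  "local_info m e j t =
     local_events m e j t \<union>
     (\<Union>i\<in>target_nbhd m e j t. \<Union>k\<in>collaborators m e i j t. local_events m e k t)"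

definition valid_execution :: "model \<Rightarrow> execution \<Rightarrow> bool" where
  "valid_execution m e \<longleftrightarrow>
     (\<forall>j\<in>{1..agents m}. valid_agent m e j) \<and>
     (\<forall>i\<in>{1..targets m}. valid_uncertainty m e i) \<and>
     finite {(t, ev). t \<in> {0..horizon m} \<and> ev \<in> all_events m \<and> occurs m e ev t}"


section \<open>IPA gradients\<close>

text \<open>The components of \<open>\<nabla>\<^sub>j\<close> are indexed by the switching points and dwell times of agent \<open>j\<close>.\<close>

datatype coord = Switch nat | Dwell nat

definition coords :: "execution \<Rightarrow> nat \<Rightarrow> coord set" where
  "coords e j = Switch ` {..<length (switches e j)} \<union> Dwell ` {..<length (dwells e j)}"

fun coord_val :: "execution \<Rightarrow> nat \<Rightarrow> coord \<Rightarrow> real" where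
  "coord_val e j (Switch l) = switches e j ! l"
| "coord_val e j (Dwell l) = dwells e j ! l"

fun coord_dom :: "model \<Rightarrow> coord \<Rightarrow> real set" where
  "coord_dom m (Switch l) = {0..len m}"
| "coord_dom m (Dwell l) = {0..}"

fun traj_upd :: "execution \<Rightarrow> nat \<Rightarrow> coord \<Rightarrow> real \<Rightarrow> real \<Rightarrow> real" where
  "traj_upd e j (Switch l) y = traj (init e j) (zip ((switches e j)[l := y]) (dwells e j))"
| "traj_upd e j (Dwell l) y = traj (init e j) (zip (switches e j) ((dwells e j)[l := y]))"

text \<open>\<open>G c t\<close> is the \<open>c\<close>-component of \<open>\<nabla>\<^sub>j s\<^sub>j(t)\<close>. Derivatives are one-sided at the boundary of the
  parameter domain, e.g. for a dwell time \<open>0\<close>.\<close>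

definition traj_gradient :: "model \<Rightarrow> execution \<Rightarrow> nat \<Rightarrow> (coord \<Rightarrow> real \<Rightarrow> real) \<Rightarrow> bool" where
  "traj_gradient m e j G \<longleftrightarrow>
     (\<forall>c\<in>coords e j.
        (\<forall>t. 0 < t \<and> t < horizon m \<and> (\<forall>ev\<in>agent_events j. \<not> occurs m e ev t) \<longrightarrow>
           ((\<lambda>y. traj_upd e j c y t) has_real_derivative G c t)
             (at (coord_val e j c) within coord_dom m c)) \<and>
        (\<forall>t\<in>{0..<horizon m}. continuous (at_right t) (G c)))"

definition ipa_rate :: "model \<Rightarrow> execution \<Rightarrow> nat \<Rightarrow> (coord \<Rightarrow> real \<Rightarrow> real) \<Rightarrow> nat \<Rightarrow> coord \<Rightarrow> real \<Rightarrow> real" where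
  "ipa_rate m e j G i c t =
     (if at_rest m e i t then 0
      else - decay m i * detect_deriv m i j (pos e j t) * G c t *
             (\<Prod>g\<in>collaborators m e i j t. 1 - detect m i (pos e g t)))"

text \<open>\<open>D i c t\<close> is the \<open>c\<close>-component of \<open>\<nabla>\<^sub>j R\<^sub>i(t)\<close>. The finite exceptional set contains the event
  times and also the instants at which agent \<open>j\<close> crosses the kink \<open>x\<^sub>i\<close> of the detection probability:
  there \<open>\<partial>p\<^sub>i\<^sub>j/\<partial>s\<^sub>j\<close> jumps without any event taking place.\<close>

definition ipa_derivative ::
  "model \<Rightarrow> execution \<Rightarrow> nat \<Rightarrow> (coord \<Rightarrow> real \<Rightarrow> real) \<Rightarrow> (nat \<Rightarrow> coord \<Rightarrow> real \<Rightarrow> real) \<Rightarrow> bool" where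
  "ipa_derivative m e j G D \<longleftrightarrow>
     (\<forall>i\<in>{1..targets m}. \<forall>c\<in>coords e j.
        D i c 0 = 0 \<and>
        (\<forall>t\<in>{0..<horizon m}. continuous (at_right t) (D i c)) \<and>
        (\<exists>X. finite X \<and> (\<forall>t\<in>{0<..<horizon m} - X.
           (D i c has_real_derivative ipa_rate m e j G i c t) (at t))) \<and>
        (\<forall>t\<in>{0<..horizon m}.
           if occurs m e (Unc_Hits i) t then D i c t = 0 else continuous (at_left t) (D i c)))"

definition ipa_gradient :: "model \<Rightarrow> (nat \<Rightarrow> coord \<Rightarrow> real \<Rightarrow> real) \<Rightarrow> coord \<Rightarrow> real" where
  "ipa_gradient m D c = 1 / horizon m * (\<Sum>i\<in>{1..targets m}. integral {0..horizon m} (D i c))"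


section \<open>The limited information model\<close>

definition observation :: "model \<Rightarrow> execution \<Rightarrow> nat \<Rightarrow> real \<Rightarrow> (nat \<rightharpoonup> real)" where
  "observation m e j t =
     (\<lambda>i. if i \<in> {1..targets m} \<and> 0 < detect m i (pos e j t) then Some (unc e i t) else None)"

text \<open>The condition \<open>k \<in> agent_nbrs m e j t\<close> (communication is possible) is automatic in a valid model.\<close>

definition informants :: "model \<Rightarrow> execution \<Rightarrow> nat \<Rightarrow> real \<Rightarrow> nat set" where
  "informants m e j t =
     {k \<in> agent_nbrs m e j t. \<exists>i\<in>target_nbhd m e j t. k \<in> collaborators m e i j t}"

text \<open>Everything agent \<open>j\<close> knows during \<open>[0,T]\<close> apart from the model constants, if it is given the
  event sets \<open>Ev t\<close>: its own initial position and parameters (hence its trajectory), its observations,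
  the reports of its neighbors, and which events of \<open>Ev t\<close> occur at which times \<open>t\<close>. Initial positions
  of other agents and unobserved uncertainties are not part of it.\<close>

definition knowledge :: "model \<Rightarrow> execution \<Rightarrow> nat \<Rightarrow> (real \<Rightarrow> event set) \<Rightarrow>
    (real \<times> real list \<times> real list) \<times>
    (real \<times> (nat \<rightharpoonup> real)) set \<times>
    (real \<times> nat \<times> real \<times> real \<times> (nat \<rightharpoonup> real)) set \<times>
    (real \<times> event) set" where
  "knowledge m e j Ev =
     ((init e j, switches e j, dwells e j),
      {(t, observation m e j t) | t. t \<in> {0..horizon m}},
      {(t, k, pos e k t, speed e k t, observation m e k t) | t k.
         t \<in> {0..horizon m} \<and> k \<in> informants m e j t},
      {(t, ev). t \<in> {0..horizon m} \<and> ev \<in> Ev t \<and> occurs m e ev t})"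

text \<open>The IPA gradient of agent \<open>j\<close> is uniquely determined by its knowledge, where \<open>Ev\<close> assigns to
  each execution the time-dependent set of events whose occurrences agent \<open>j\<close> is given.\<close>

definition sufficient_event_set :: "model \<Rightarrow> nat \<Rightarrow> (execution \<Rightarrow> real \<Rightarrow> event set) \<Rightarrow> bool" where
  "sufficient_event_set m j Ev \<longleftrightarrow>
     (\<forall>e G D e' G' D'.
        valid_execution m e \<and> traj_gradient m e j G \<and> ipa_derivative m e j G D \<and>
        valid_execution m e' \<and> traj_gradient m e' j G' \<and> ipa_derivative m e' j G' D' \<and>
        knowledge m e j (Ev e) = knowledge m e' j (Ev e') \<longrightarrow>
        (\<forall>c\<in>coords e j. ipa_gradient m D c = ipa_gradient m D' c))"

end

theory Submission
  imports Defs
begin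

text \<open>Two executions with the same knowledge of agent \<open>j\<close> share its trajectory, hence \<open>\<nabla>\<^sub>j s\<^sub>j\<close>.
  While target \<open>i\<close> is out of range, \<open>\<nabla>\<^sub>j R\<^sub>i\<close> has rate \<open>0\<close> whatever the other agents do. While it is in
  range, every agent contributing to \<open>P\<^sub>i\<close> lies within \<open>2r \<le> r\<^sub>c\<close> of agent \<open>j\<close> and reports its position,
  and \<open>R\<^sub>i\<close> is observed, so the rates agree again. All resets are known, so the difference of
  the two IPA derivatives has derivative \<open>0\<close> off a finite set, jumps at most to \<open>0\<close>, and starts at \<open>0\<close>.\<close>

section \<open>Piecewise constant functions\<close>

text \<open>A finite set has no limit point, so \<open>f\<close> vanishes just to the right of
  \<open>t\<close>, and right-continuity carries the value back to \<open>t\<close>. This recovers a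
  trajectory gradient at the control switches, where no derivative is prescribed.\<close>

lemma right_continuous_zero_off_finite:
  fixes f :: "real \<Rightarrow> real"
  assumes "finite F" and "t < T" and "continuous (at_right t) f"
    and zero: "\<And>\<tau>. t < \<tau> \<Longrightarrow> \<tau> < T \<Longrightarrow> \<tau> \<notin> F \<Longrightarrow> f \<tau> = 0"
  shows "f t = 0"
proof -
  have "eventually (\<lambda>\<tau>. \<tau> \<notin> F) (at t)"
    using islimpt_finite[OF \<open>finite F\<close>, of t]
    by (simp add: islimpt_iff_eventually)
  then have "eventually (\<lambda>\<tau>. \<tau> \<notin> F) (at_right t)"
    using eventually_at_split by blast
  moreover have "eventually (\<lambda>\<tau>. \<tau> \<in> {t<..<T}) (at_right t)"
    using \<open>t < T\<close> by (rule eventually_at_right_real)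
  ultimately have "eventually (\<lambda>\<tau>. f \<tau> = 0) (at_right t)"
    by eventually_elim (use zero in auto)
  then have "(f \<longlongrightarrow> 0) (at_right t)"
    by (rule tendsto_eventually)
  then show ?thesis
    using assms(3) tendsto_unique[OF trivial_limit_at_right_real]
    by (auto simp: continuous_within)
qed

text \<open>The mean value theorem on \<open>{a..x}\<close> gives this. Only right-continuity is
  available at \<open>a\<close>, and \<open>b\<close> is left out, because \<open>f\<close> may jump
  at both ends.\<close>

lemma zero_on_gap:
  fixes f :: "real \<Rightarrow> real"
  assumes "a < b" "f a = 0" and right: "continuous (at_right a) f"
    and deriv: "\<And>x. a < x \<Longrightarrow> x < b \<Longrightarrow> (f has_real_derivative 0) (at x)"
    and "a \<le> x" "x < b"
  shows "f x = 0"
proof (cases "x = a")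
  case False
  have "continuous (at y within {a..x}) f" if "y \<in> {a..x}" for y
  proof (cases "y = a")
    case True
    then show ?thesis
      using right \<open>x \<noteq> a\<close> \<open>a \<le> x\<close> by (simp add: continuous_within at_within_Icc_at_right)
  next
    case False
    then show ?thesis
      using that deriv[of y] \<open>x < b\<close> DERIV_isCont continuous_at_imp_continuous_at_within
      by (metis atLeastAtMost_iff le_less_trans order_less_le)
  qed
  then have "continuous_on {a..x} f"
    by (simp add: continuous_on_eq_continuous_within)
  then have "f x = f a"
    by (intro DERIV_isconst_end) (use False assms in auto)
  then show ?thesis
    using assms by simp
qed (use assms in simp)

text \<open>Zero propagates from one exceptional point to the next: it persists across each gap, and
  at the far end the value is either reset to 0 or equal to a left limit of zeros. The induction
  counts the exceptional points strictly before \<open>t\<close>.\<close>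

lemma zero_if_piecewise_constant:
  fixes f :: "real \<Rightarrow> real"
  assumes "finite X" and start: "f 0 = 0"
    and right: "\<And>t. 0 \<le> t \<Longrightarrow> t < T \<Longrightarrow> continuous (at_right t) f"
    and deriv: "\<And>t. 0 < t \<Longrightarrow> t < T \<Longrightarrow> t \<notin> X \<Longrightarrow> (f has_real_derivative 0) (at t)"
    and left: "\<And>t. 0 < t \<Longrightarrow> t \<le> T \<Longrightarrow> f t = 0 \<or> continuous (at_left t) f"
  shows "0 \<le> t \<Longrightarrow> t \<le> T \<Longrightarrow> f t = 0"
proof (induction "card {x\<in>X. x < t}" arbitrary: t rule: less_induct)
  case less
  show ?case
  proof (cases "t = 0")
    case False
    \<comment> \<open>\<open>s\<close> will be the last exceptional point in \<open>{0..<t}\<close>,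
      or 0 if there is none, so that the open gap from \<open>s\<close> to \<open>t\<close> avoids
      \<open>X\<close>.\<close>
    define S where "S = insert 0 {x\<in>X. 0 \<le> x \<and> x < t}"
    define s where "s = Max S"
    have fin: "finite S" and "S \<noteq> {}"
      using \<open>finite X\<close> by (auto simp: S_def)
    have "s \<in> S"
      using Max_in[OF fin \<open>S \<noteq> {}\<close>] by (simp add: s_def)
    have "0 \<le> s" "s < t"
      using \<open>s \<in> S\<close> less.prems False by (auto simp: S_def)
    have gap: "x \<notin> X" if "s < x" "x < t" for x
    proof
      assume "x \<in> X"
      then have "x \<in> S"
        using that \<open>0 \<le> s\<close> by (simp add: S_def)
      then show False
        using that Max_ge[OF fin] by (simp add: s_def leD)
    qed
    have "f s = 0"
    proof (cases "s = 0")
      case s: False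
      \<comment> \<open>The inclusion is strict because a nonzero \<open>s\<close> lies in
        \<open>X\<close> and is counted for \<open>t\<close> but not for itself.\<close>
      then have "{x\<in>X. x < s} \<subset> {x\<in>X. x < t}"
        using \<open>s \<in> S\<close> by (auto simp: S_def)
      then have "card {x\<in>X. x < s} < card {x\<in>X. x < t}"
        using \<open>finite X\<close> by (intro psubset_card_mono) auto
      then show ?thesis
        using less \<open>0 \<le> s\<close> \<open>s < t\<close> by simp
    qed (use start in simp)
    have zero: "f x = 0" if "s \<le> x" "x < t" for x
      using zero_on_gap[of s t f x] that \<open>f s = 0\<close> \<open>s < t\<close> \<open>0 \<le> s\<close> less.prems right deriv gap
      by simp
    have "eventually (\<lambda>x. f x = 0) (at_left t)"
      using eventually_at_left_real[OF \<open>s < t\<close>] by eventually_elim (simp add: zero)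
    then have "(f \<longlongrightarrow> 0) (at_left t)"
      by (rule tendsto_eventually)
    moreover have "f t = 0 \<or> (f \<longlongrightarrow> f t) (at_left t)"
      using left[of t] less.prems False by (auto simp: continuous_within)
    ultimately show ?thesis
      using tendsto_unique[OF trivial_limit_at_left_real] by blast
  qed (use start in simp)
qed

lemma has_real_derivative_within_unique:
  assumes "(f has_real_derivative a) (at x within S)" "(f has_real_derivative b) (at x within S)"
    and "x islimpt S"
  shows "a = b"
  using assms tendsto_unique[of "at x within S"]
  by (auto simp: has_field_derivative_iff trivial_limit_within)


section \<open>Gradient of the trajectory\<close>

text \<open>Derivatives in the parameters are taken within \<open>coord_dom\<close>; at a limit
  point of that domain they are unique, even when one-sided.\<close>

lemma coord_val_islimpt:
  assumes "valid_model m" "valid_agent m e j" "c \<in> coords e j"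
  shows "coord_val e j c islimpt coord_dom m c"
proof (cases c)
  case (Switch l)
  then have "switches e j ! l \<in> {0..len m}"
    using assms by (intro subsetD[OF _ nth_mem]) (auto simp: coords_def valid_agent_def)
  then show ?thesis
    using Switch assms by (simp add: valid_model_def islimpt_Icc)
next
  case (Dwell l)
  then have "dwells e j ! l \<in> {0..}"
    using assms by (intro subsetD[OF _ nth_mem]) (auto simp: coords_def valid_agent_def)
  \<comment> \<open>The unit interval above the dwell time stays inside the half-line, which also
    covers dwell time 0.\<close>
  then have "dwells e j ! l islimpt {0..dwells e j ! l + 1}"
    by (simp add: islimpt_Icc)
  then show ?thesis
    using Dwell by (auto elim: islimpt_subset)
qed

text \<open>These times are projections of the finitely many (time, event) pairs of a valid
  execution; a \<open>Control_Switch\<close> can only occur inside the horizon.\<close>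

lemma finite_agent_event_times:
  assumes "valid_execution m e" "j \<in> {1..agents m}"
  shows "finite {t. \<exists>ev\<in>agent_events j. occurs m e ev t}"
proof (rule finite_subset)
  let ?E = "{(t, ev). t \<in> {0..horizon m} \<and> ev \<in> all_events m \<and> occurs m e ev t}"
  show "finite (fst ` ?E)"
    using assms by (simp add: valid_execution_def)
  have "t \<in> {0..horizon m}" if "ev \<in> agent_events j" "occurs m e ev t" for t ev
    using that by (auto simp: agent_events_def)
  then show "{t. \<exists>ev\<in>agent_events j. occurs m e ev t} \<subseteq> fst ` ?E"
    using assms(2) by (force simp: all_events_def)
qed

text \<open>Away from control switches both gradients differentiate the same function of the
  parameter at the same point. At the finitely many switches right-continuity decides, hence the
  restriction to times before the horizon.\<close>

lemma traj_gradient_unique: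
  assumes "valid_model m" "valid_execution m e" "j \<in> {1..agents m}" "c \<in> coords e j"
    and own: "init e j = init e' j" "switches e j = switches e' j" "dwells e j = dwells e' j"
    and G: "traj_gradient m e j G" and G': "traj_gradient m e' j G'"
    and t: "0 \<le> t" "t < horizon m"
  shows "G c t = G' c t"
proof -
  have c': "c \<in> coords e' j" and val: "coord_val e' j c = coord_val e j c"
    and upd: "traj_upd e' j c = traj_upd e j c"
    using assms(4) own by (auto simp: coords_def fun_eq_iff)
  have "speed e j = speed e' j"
    using own by (simp add: speed_def)
  \<comment> \<open>Control switches depend on the speed of agent \<open>j\<close> alone, so the
    exceptional times of \<open>e\<close> also serve for \<open>e'\<close>.\<close>
  then have ev: "occurs m e ev \<tau> \<longleftrightarrow> occurs m e' ev \<tau>" if "ev \<in> agent_events j" for ev \<tau>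
    using that by (auto simp: agent_events_def)
  let ?F = "{t. \<exists>ev\<in>agent_events j. occurs m e ev t}"
  have lim: "coord_val e j c islimpt coord_dom m c"
    using assms by (intro coord_val_islimpt) (auto simp: valid_execution_def)
  have "G c \<tau> - G' c \<tau> = 0" if "t < \<tau>" "\<tau> < horizon m" "\<tau> \<notin> ?F" for \<tau>
  proof -
    have "((\<lambda>y. traj_upd e j c y \<tau>) has_real_derivative G c \<tau>)
            (at (coord_val e j c) within coord_dom m c)"
      using G that t assms(4) by (auto simp: traj_gradient_def)
    moreover have "((\<lambda>y. traj_upd e j c y \<tau>) has_real_derivative G' c \<tau>)
            (at (coord_val e j c) within coord_dom m c)"
      using G' that t c' ev unfolding traj_gradient_def upd[symmetric] val[symmetric]
      by auto
    ultimately show ?thesis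
      using has_real_derivative_within_unique lim by simp
  qed
  moreover have "continuous (at_right t) (\<lambda>\<tau>. G c \<tau> - G' c \<tau>)"
    using G G' t assms(4) c' by (intro continuous_diff) (auto simp: traj_gradient_def)
  ultimately have "G c t - G' c t = 0"
    by (rule right_continuous_zero_off_finite
        [OF finite_agent_event_times[OF assms(2,3)] t(2), rotated])
  then show ?thesis
    by simp
qed


section \<open>What the knowledge of an agent determines\<close>

text \<open>Triangle inequality through the target: two agents within \<open>sense m\<close> of it
  are at most \<open>2 * sense m\<close> apart, hence within communication range.\<close>

lemma informantsI:
  assumes "valid_model m" "i \<in> target_nbhd m e j t" "k \<in> collaborators m e i j t"
  shows "k \<in> informants m e j t"
proof -
  have "\<bar>loc m i - pos e j t\<bar> \<le> sense m" "\<bar>pos e k t - loc m i\<bar> \<le> sense m"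
      "2 * sense m \<le> comm m"
    using assms
    by (simp_all add: target_nbhd_def collaborators_def agent_nbhd_def valid_model_def)
  then have "\<bar>pos e k t - pos e j t\<bar> \<le> comm m"
    by linarith
  then have "k \<in> agent_nbrs m e j t"
    using assms(3) by (simp add: agent_nbrs_def collaborators_def agent_nbhd_def)
  then show ?thesis
    using assms(2,3) unfolding informants_def by blast
qed

lemma knowledge_own:
  assumes "knowledge m e j Ev = knowledge m e' j Ev'"
  shows "init e j = init e' j" "switches e j = switches e' j" "dwells e j = dwells e' j"
    "pos e j = pos e' j"
proof -
  show own: "init e j = init e' j" "switches e j = switches e' j" "dwells e j = dwells e' j"
    using assms unfolding knowledge_def by (simp_all only: prod.inject)
  show "pos e j = pos e' j"
    by (simp add: pos_def own)
qed

lemma knowledge_unc: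
  assumes K: "knowledge m e j Ev = knowledge m e' j Ev'" and "t \<in> {0..horizon m}"
    and "i \<in> {1..targets m}" "0 < detect m i (pos e j t)"
  shows "unc e i t = unc e' i t"
proof -
  have "{(t, observation m e j t) | t. t \<in> {0..horizon m}} =
        {(t, observation m e' j t) | t. t \<in> {0..horizon m}}"
    using K unfolding knowledge_def by (simp only: prod.inject)
  then have "(t, observation m e j t) \<in> {(t, observation m e' j t) | t. t \<in> {0..horizon m}}"
    using assms(2) by blast
  then have "observation m e j t = observation m e' j t"
    by blast
  then have "observation m e j t i = observation m e' j t i"
    by simp
  then show ?thesis
    using assms knowledge_own(4)[OF K] by (simp add: observation_def)
qed

text \<open>Each report carries its time and sender, so finding it in the knowledge of the other
  execution identifies the position.\<close>

lemma knowledge_informants: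
  assumes K: "knowledge m e j Ev = knowledge m e' j Ev'" and "t \<in> {0..horizon m}"
    and "k \<in> informants m e j t"
  shows "pos e k t = pos e' k t"
proof -
  have "{(t, k, pos e k t, speed e k t, observation m e k t) | t k.
           t \<in> {0..horizon m} \<and> k \<in> informants m e j t} =
        {(t, k, pos e' k t, speed e' k t, observation m e' k t) | t k.
           t \<in> {0..horizon m} \<and> k \<in> informants m e' j t}"
    using K unfolding knowledge_def by (simp only: prod.inject)
  then have "(t, k, pos e k t, speed e k t, observation m e k t) \<in>
      {(t, k, pos e' k t, speed e' k t, observation m e' k t) | t k.
         t \<in> {0..horizon m} \<and> k \<in> informants m e' j t}"
    using assms(2,3) by blast
  then show ?thesis
    by blast
qed

text \<open>The event sets depend on the execution. Membership in both makes the absence of a record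
  mean that the event does not occur.\<close>

lemma knowledge_occurs:
  assumes K: "knowledge m e j Ev = knowledge m e' j Ev'" and "t \<in> {0..horizon m}"
    and "ev \<in> Ev t" "ev \<in> Ev' t"
  shows "occurs m e ev t \<longleftrightarrow> occurs m e' ev t"
proof -
  have "{(t, ev). t \<in> {0..horizon m} \<and> ev \<in> Ev t \<and> occurs m e ev t} =
        {(t, ev). t \<in> {0..horizon m} \<and> ev \<in> Ev' t \<and> occurs m e' ev t}"
    using K unfolding knowledge_def by (simp only: prod.inject)
  then have "(t, ev) \<in> {(t, ev). t \<in> {0..horizon m} \<and> ev \<in> Ev t \<and> occurs m e ev t} \<longleftrightarrow>
      (t, ev) \<in> {(t, ev). t \<in> {0..horizon m} \<and> ev \<in> Ev' t \<and> occurs m e' ev t}"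
    by simp
  then show ?thesis
    using assms(2-4) by simp
qed

text \<open>Membership in \<open>collaborators\<close> is a condition on positions. An agent that
  reports in one execution has the same position in the other and so satisfies the condition there;
  swapping the executions gives the reverse inclusion.\<close>

lemma knowledge_collaborators:
  assumes "valid_model m" and K: "knowledge m e j Ev = knowledge m e' j Ev'"
    and t: "t \<in> {0..horizon m}" and i: "i \<in> target_nbhd m e j t"
  shows "collaborators m e i j t = collaborators m e' i j t"
    and "\<And>k. k \<in> collaborators m e i j t \<Longrightarrow> pos e k t = pos e' k t"
proof -
  have i': "i \<in> target_nbhd m e' j t"
    using i knowledge_own(4)[OF K] by (simp add: target_nbhd_def)
  show *: "pos e k t = pos e' k t" if "k \<in> collaborators m e i j t" for k
    using knowledge_informants[OF K t] informantsI[OF assms(1) i that] by blast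
  have **: "pos e' k t = pos e k t" if "k \<in> collaborators m e' i j t" for k
    using knowledge_informants[OF K[symmetric] t] informantsI[OF assms(1) i' that] by blast
  show "collaborators m e i j t = collaborators m e' i j t"
  proof (intro set_eqI iffI)
    show "k \<in> collaborators m e' i j t" if "k \<in> collaborators m e i j t" for k
      using that *[OF that] by (simp add: collaborators_def agent_nbhd_def)
    show "k \<in> collaborators m e i j t" if "k \<in> collaborators m e' i j t" for k
      using that **[OF that] by (simp add: collaborators_def agent_nbhd_def)
  qed
qed

lemma detect_eq_0_iff:
  assumes "valid_model m"
  shows "detect m i s = 0 \<longleftrightarrow> sense m \<le> \<bar>loc m i - s\<bar>"
  using assms by (auto simp: detect_def valid_model_def max_def field_simps)

text \<open>Agents out of range contribute a factor 1, so only positions that can be known to an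
  agent sensing the target enter \<open>joint_detect\<close>.\<close>

lemma joint_detect_agent_nbhd:
  assumes "valid_model m"
  shows "joint_detect m e i t = 1 - (\<Prod>k\<in>agent_nbhd m e i t. 1 - detect m i (pos e k t))"
proof -
  have "(\<Prod>k\<in>{1..agents m}. 1 - detect m i (pos e k t)) =
        (\<Prod>k\<in>agent_nbhd m e i t. 1 - detect m i (pos e k t))"
    using assms
    by (intro prod.mono_neutral_right) (auto simp: agent_nbhd_def detect_eq_0_iff)
  then show ?thesis
    by (simp add: joint_detect_def)
qed

lemma knowledge_ipa_rate:
  assumes "valid_model m" and K: "knowledge m e j Ev = knowledge m e' j Ev'"
    and t: "t \<in> {0..horizon m}" and i: "i \<in> {1..targets m}"
    and G: "G c t = G' c t"
  shows "ipa_rate m e j G i c t = ipa_rate m e' j G' i c t"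
proof (cases "detect m i (pos e j t) = 0")
  case True
  then show ?thesis
    \<comment> \<open>\<open>detect_deriv\<close> is 0 here, so both branches of
      \<open>ipa_rate\<close> vanish, whatever \<open>at_rest\<close> and the product over the
      collaborators are.\<close>
    using knowledge_own(4)[OF K] by (simp add: ipa_rate_def detect_deriv_def)
next
  case False
  then have nbhd: "i \<in> target_nbhd m e j t"
    using assms(1) i by (auto simp: target_nbhd_def detect_eq_0_iff)
  have pos: "0 < detect m i (pos e j t)"
    using False by (simp add: order_less_le) (simp add: detect_def)
  note coll = knowledge_collaborators[OF assms(1) K t nbhd]
  \<comment> \<open>\<open>collaborators\<close> leaves out \<open>j\<close>, whereas
    \<open>joint_detect\<close> ranges over all agents near the target; the known position of
    \<open>j\<close> closes the gap.\<close>
  have "j \<in> agent_nbhd m e i t \<longleftrightarrow> j \<in> agent_nbhd m e' i t"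
    using knowledge_own(4)[OF K] by (simp add: agent_nbhd_def)
  then have nbrs: "agent_nbhd m e i t = agent_nbhd m e' i t"
    using coll(1) unfolding collaborators_def by blast
  have near: "pos e k t = pos e' k t" if "k \<in> agent_nbhd m e i t" for k
    using that coll(2)[of k] knowledge_own(4)[OF K]
    by (cases "k = j") (simp_all add: collaborators_def)
  have "joint_detect m e i t = joint_detect m e' i t"
    unfolding joint_detect_agent_nbhd[OF assms(1)] using near nbrs
    by (intro arg_cong2[of _ _ _ _ minus] prod.cong) simp_all
  then have "at_rest m e i t = at_rest m e' i t"
    using knowledge_unc[OF K t i pos] by (simp add: at_rest_def)
  moreover have "(\<Prod>g\<in>collaborators m e i j t. 1 - detect m i (pos e g t)) =
      (\<Prod>g\<in>collaborators m e' i j t. 1 - detect m i (pos e' g t))"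
    using coll by (intro prod.cong) simp_all
  ultimately show ?thesis
    using G knowledge_own(4)[OF K] by (simp add: ipa_rate_def)
qed


section \<open>The IPA gradient\<close>

lemma ipa_derivativeE:
  assumes "ipa_derivative m e j G D" "i \<in> {1..targets m}" "c \<in> coords e j"
  obtains X where "finite X" and "D i c 0 = 0"
    and "\<And>t. 0 \<le> t \<Longrightarrow> t < horizon m \<Longrightarrow> continuous (at_right t) (D i c)"
    and "\<And>t. 0 < t \<Longrightarrow> t < horizon m \<Longrightarrow> t \<notin> X \<Longrightarrow>
      (D i c has_real_derivative ipa_rate m e j G i c t) (at t)"
    and "\<And>t. 0 < t \<Longrightarrow> t \<le> horizon m \<Longrightarrow> occurs m e (Unc_Hits i) t \<Longrightarrow> D i c t = 0"
    and "\<And>t. 0 < t \<Longrightarrow> t \<le> horizon m \<Longrightarrow> \<not> occurs m e (Unc_Hits i) t \<Longrightarrow>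
      continuous (at_left t) (D i c)"
proof -
  note * = bspec[OF bspec[OF assms(1)[unfolded ipa_derivative_def] assms(2)] assms(3)]
  note left = bspec[OF conjunct2[OF conjunct2[OF conjunct2[OF *]]]]
  from conjunct1[OF conjunct2[OF conjunct2[OF *]]]
  obtain X where X: "finite X" "\<forall>t\<in>{0<..<horizon m} - X.
      (D i c has_real_derivative ipa_rate m e j G i c t) (at t)"
    by (elim exE conjE)
  show thesis
  proof (rule that[OF X(1) conjunct1[OF *]])
    show "continuous (at_right t) (D i c)" if "0 \<le> t" "t < horizon m" for t
      using that bspec[OF conjunct1[OF conjunct2[OF *]], of t] by simp
    show "(D i c has_real_derivative ipa_rate m e j G i c t) (at t)"
      if "0 < t" "t < horizon m" "t \<notin> X" for t
      using that bspec[OF X(2), of t] by simp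
    show "D i c t = 0" if "0 < t" "t \<le> horizon m" "occurs m e (Unc_Hits i) t" for t
      using that left[of t] by simp
    show "continuous (at_left t) (D i c)"
      if "0 < t" "t \<le> horizon m" "\<not> occurs m e (Unc_Hits i) t" for t
      using that left[of t] by simp
  qed
qed

text \<open>The difference of the two derivatives is piecewise constant off the union of their
  exceptional sets. At a common reset both terms are 0, and at any other time both are
  left-continuous, so the difference never leaves 0.\<close>

lemma ipa_derivative_unique:
  assumes D: "ipa_derivative m e j G D" and D': "ipa_derivative m e' j G' D'"
    and i: "i \<in> {1..targets m}" and c: "c \<in> coords e j" "c \<in> coords e' j"
    and rate: "\<And>t. 0 < t \<Longrightarrow> t < horizon m \<Longrightarrow>
      ipa_rate m e j G i c t = ipa_rate m e' j G' i c t"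
    and resets: "\<And>t. 0 < t \<Longrightarrow> t \<le> horizon m \<Longrightarrow>
      occurs m e (Unc_Hits i) t \<longleftrightarrow> occurs m e' (Unc_Hits i) t"
    and t: "0 \<le> t" "t \<le> horizon m"
  shows "D i c t = D' i c t"
proof -
  obtain X where X: "finite X" and D:
      "D i c 0 = 0"
      "\<And>t. 0 \<le> t \<Longrightarrow> t < horizon m \<Longrightarrow> continuous (at_right t) (D i c)"
      "\<And>t. 0 < t \<Longrightarrow> t < horizon m \<Longrightarrow> t \<notin> X \<Longrightarrow>
        (D i c has_real_derivative ipa_rate m e j G i c t) (at t)"
      "\<And>t. 0 < t \<Longrightarrow> t \<le> horizon m \<Longrightarrow> occurs m e (Unc_Hits i) t \<Longrightarrow> D i c t = 0"
      "\<And>t. 0 < t \<Longrightarrow> t \<le> horizon m \<Longrightarrow> \<not> occurs m e (Unc_Hits i) t \<Longrightarrow>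
        continuous (at_left t) (D i c)"
    by (rule ipa_derivativeE[OF D i c(1)]; rule that)
  obtain X' where X': "finite X'" and D':
      "D' i c 0 = 0"
      "\<And>t. 0 \<le> t \<Longrightarrow> t < horizon m \<Longrightarrow> continuous (at_right t) (D' i c)"
      "\<And>t. 0 < t \<Longrightarrow> t < horizon m \<Longrightarrow> t \<notin> X' \<Longrightarrow>
        (D' i c has_real_derivative ipa_rate m e' j G' i c t) (at t)"
      "\<And>t. 0 < t \<Longrightarrow> t \<le> horizon m \<Longrightarrow> occurs m e' (Unc_Hits i) t \<Longrightarrow> D' i c t = 0"
      "\<And>t. 0 < t \<Longrightarrow> t \<le> horizon m \<Longrightarrow> \<not> occurs m e' (Unc_Hits i) t \<Longrightarrow>
        continuous (at_left t) (D' i c)"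
    by (rule ipa_derivativeE[OF D' i c(2)]; rule that)
  have "D i c t - D' i c t = 0"
  proof (rule zero_if_piecewise_constant[of "X \<union> X'" "\<lambda>t. D i c t - D' i c t" "horizon m"])
    show "finite (X \<union> X')" "D i c 0 - D' i c 0 = 0"
      using X X' D(1) D'(1) by simp_all
    show "continuous (at_right t) (\<lambda>t. D i c t - D' i c t)" if "0 \<le> t" "t < horizon m" for t
      using D(2) D'(2) that by (intro continuous_diff)
    show "((\<lambda>t. D i c t - D' i c t) has_real_derivative 0) (at t)"
      if "0 < t" "t < horizon m" "t \<notin> X \<union> X'" for t
      using DERIV_diff[OF D(3) D'(3), of t] rate[of t] that by simp
    show "D i c t - D' i c t = 0 \<or> continuous (at_left t) (\<lambda>t. D i c t - D' i c t)"
      if "0 < t" "t \<le> horizon m" for t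
    proof (cases "occurs m e (Unc_Hits i) t")
      case True
      then show ?thesis
        using D(4) D'(4) resets that by simp
    next
      case False
      then show ?thesis
        using D(5) D'(5) resets that by (intro disjI2 continuous_diff) blast+
    qed
  qed (use t in simp_all)
  then show ?thesis
    by simp
qed

theorem lemma2:
  fixes m :: model and j :: nat
  assumes "valid_model m" and "j \<in> {1..agents m}"
  shows "sufficient_event_set m j
    (\<lambda>e t. local_info m e j t \<union> {Unc_Hits i | i. i \<in> {1..targets m} - target_nbhd m e j t})"
  unfolding sufficient_event_set_def
proof (intro allI impI ballI, elim conjE)
  define Ev where "Ev e t =
    local_info m e j t \<union> {Unc_Hits i | i. i \<in> {1..targets m} - target_nbhd m e j t}" for e t
  fix e G D e' G' D' c
  assume e: "valid_execution m e" and G: "traj_gradient m e j G" and D: "ipa_derivative m e j G D"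
    and G': "traj_gradient m e' j G'" and D': "ipa_derivative m e' j G' D'"
    and c: "c \<in> coords e j"
    and "knowledge m e j (\<lambda>t. local_info m e j t \<union>
        {Unc_Hits i | i. i \<in> {1..targets m} - target_nbhd m e j t}) =
      knowledge m e' j (\<lambda>t. local_info m e' j t \<union>
        {Unc_Hits i | i. i \<in> {1..targets m} - target_nbhd m e' j t})"
  then have K: "knowledge m e j (Ev e) = knowledge m e' j (Ev e')"
    by (simp add: Ev_def[abs_def])
  note own = knowledge_own(1-3)[OF K]
  have c': "c \<in> coords e' j"
    using c own by (simp add: coords_def)
  \<comment> \<open>This is where the added events enter: resets of targets in
    \<open>target_nbhd\<close> belong to \<open>local_info\<close>, all others to the added set, so
    every reset is known at its time of occurrence.\<close>
  have hits: "Unc_Hits i \<in> Ev e t" if "i \<in> {1..targets m}" for e i t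
    using that by (auto simp: Ev_def local_info_def local_events_def target_events_def)
  have "D i c t = D' i c t" if i: "i \<in> {1..targets m}" and "t \<in> {0..horizon m}" for i t
  proof (rule ipa_derivative_unique[OF D D' i c c'])
    show "ipa_rate m e j G i c t = ipa_rate m e' j G' i c t" if "0 < t" "t < horizon m" for t
      using that traj_gradient_unique[OF assms(1) e assms(2) c own G G']
      by (intro knowledge_ipa_rate[OF assms(1) K _ i]) auto
    show "occurs m e (Unc_Hits i) t \<longleftrightarrow> occurs m e' (Unc_Hits i) t"
      if "0 < t" "t \<le> horizon m" for t
      using that by (intro knowledge_occurs[OF K _ hits[OF i] hits[OF i]]) auto
  qed (use that in auto)
  then have "integral {0..horizon m} (D i c) = integral {0..horizon m} (D' i c)"
    if "i \<in> {1..targets m}" for i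
    using that by (intro integral_cong) auto
  then show "ipa_gradient m D c = ipa_gradient m D' c"
    by (simp add: ipa_gradient_def)
qed

end
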